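(* Let $G$ be a partial 2-tree which is a spanning subgraph of a 2-tree $G_T$. Then the complement $\overline{G}$ has a segment representation that is compatible with $G_T$.
   Context: All graphs are finite, simple and undirected. The complement $\overline{G}$ of $G$ has vertex set $V(G)$ and edge set $\{uv : u\neq v,\ uv\notin E(G)\}$. A 2-tree is defined recursively: a single edge is a 2-tree; if $H$ is a 2-tree and $xy\in E(H)$, then the graph obtained from $H$ by adding a new vertex $v$ and the edges $vx,vy$ is a 2-tree. A partial 2-tree is any spanning subgraph of a 2-tree. For points $a\neq b$ in $\mathbb{R}^2$, the segment $ab$ is $\{a+\rho(b-a):\rho\in[0,1]\}$; its end-points are $a$ and $b$, and every other point of it is an interior point. Segments are required to have non-zero length. The ray starting at $a$ and passing through $b$ is $\{a+\rho(b-a):\rho\in[0,\infty)\}$; its only end-point is $a$. Two objects $l_1,l_2$, each a segment or a ray, cross if $l_1\cap l_2$ consists of exactly one point and this point is an end-point of neither $l_1$ nor $l_2$. A segment representation of a graph $H$ is an assignment of a segment $s_u$ to each vertex $u\in V(H)$ such that for all $u\neq v$, $s_u\cap s_v\neq\emptyset$ if and only if $uv\in E(H)$. Let $G$ be a partial 2-tree, $G_T$ a 2-tree of which $G$ is a spanning subgraph, and $\mathcal{R}=\{s_u : u\in V(G)\}$ a segment representation of $\overline{G}$. Then $\mathcal{R}$ is compatible with $G_T$ if for each edge $uv\in E(G_T)$ one can choose a ray $r_{uv}$ in the plane such that: (1) $r_{uv}$ starts at an interior point of one of $s_u,s_v$, passes through an end-point of the other, and meets no other points of $s_u$ or $s_v$;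 (2) $r_{uv}$ crosses every segment $s_w$ with $w\notin\{u,v\}$; and (3) $r_{uv}$ crosses every ray $r_{xy}$ with $xy\in E(G_T)\setminus\{uv\}$. *)

theory Defs
  imports "HOL-Analysis.Analysis"
begin

section \<open>Graphs and 2-trees\<close>

text \<open>A graph is a pair (vertex set, edge set), an edge being a two-element set of vertices.\<close>

type_synonym 'a graph = "'a set \<times> 'a set set"

abbreviation verts :: "'a graph \<Rightarrow> 'a set" where "verts \<equiv> fst"
abbreviation edges :: "'a graph \<Rightarrow> 'a set set" where "edges \<equiv> snd"

definition simple_graph :: "'a graph \<Rightarrow> bool" where
  "simple_graph G \<longleftrightarrow>
     finite (verts G) \<and> (\<forall>e\<in>edges G. \<exists>u\<in>verts G. \<exists>v\<in>verts G. u \<noteq> v \<and> e = {u, v})"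

definition complement :: "'a graph \<Rightarrow> 'a graph" where
  "complement G =
     (verts G, {{u, v} | u v. u \<in> verts G \<and> v \<in> verts G \<and> u \<noteq> v \<and> {u, v} \<notin> edges G})"

inductive two_tree :: "'a graph \<Rightarrow> bool" where
  single_edge: "u \<noteq> v \<Longrightarrow> two_tree ({u, v}, {{u, v}})"
| add_vertex: "two_tree (V, E) \<Longrightarrow> {x, y} \<in> E \<Longrightarrow> v \<notin> V \<Longrightarrow>
     two_tree (insert v V, E \<union> {{v, x}, {v, y}})"

definition spanning_subgraph :: "'a graph \<Rightarrow> 'a graph \<Rightarrow> bool" where
  "spanning_subgraph G H \<longleftrightarrow> simple_graph G \<and> verts G = verts H \<and> edges G \<subseteq> edges H"

definition partial_two_tree :: "'a graph \<Rightarrow> bool" where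
  "partial_two_tree G \<longleftrightarrow> (\<exists>H. two_tree H \<and> spanning_subgraph G H)"

lemma two_tree_simple: "two_tree G \<Longrightarrow> simple_graph G"
proof (induction rule: two_tree.induct)
  case (single_edge u v)
  then show ?case by (auto simp: simple_graph_def)
next
  case (add_vertex V E x y v)
  then have "\<exists>a\<in>V. \<exists>b\<in>V. a \<noteq> b \<and> {x, y} = {a, b}"
    unfolding simple_graph_def fst_conv snd_conv by blast
  then obtain a b where "a \<in> V" "b \<in> V" "{x, y} = {a, b}" by blast
  then have xy: "x \<in> V" "y \<in> V" unfolding doubleton_eq_iff by blast+
  have "\<exists>a\<in>insert v V. \<exists>b\<in>insert v V. a \<noteq> b \<and> e = {a, b}"
    if e: "e \<in> E \<union> {{v, x}, {v, y}}" for e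
  proof -
    consider "e \<in> E" | "e = {v, x}" | "e = {v, y}" using e by blast
    then show ?thesis
    proof cases
      case 1
      then show ?thesis
        using add_vertex.IH unfolding simple_graph_def fst_conv snd_conv by blast
    next
      case 2
      moreover have "v \<noteq> x" using xy add_vertex.hyps by blast
      ultimately show ?thesis using xy
        by - (rule bexI[of _ v], rule bexI[of _ x], simp_all)
    next
      case 3
      moreover have "v \<noteq> y" using xy add_vertex.hyps by blast
      ultimately show ?thesis using xy
        by - (rule bexI[of _ v], rule bexI[of _ y], simp_all)
    qed
  qed
  moreover have "finite (insert v V)" using add_vertex.IH by (simp add: simple_graph_def)
  ultimately show ?case unfolding simple_graph_def fst_conv snd_conv by (intro conjI ballI)
qed


section \<open>Segments and rays in the plane\<close>

type_synonym point = "real ^ 2"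

text \<open>\<open>Segment a b\<close> has end-points \<open>a\<close> and \<open>b\<close>; \<open>Ray a b\<close> starts at \<open>a\<close> and passes through
  \<open>b\<close>. The requirement \<open>a \<noteq> b\<close> is imposed by \<open>is_segment\<close> and \<open>is_ray\<close>.\<close>

datatype line_object = Segment point point | Ray point point

fun points :: "line_object \<Rightarrow> point set" where
  "points (Segment a b) = closed_segment a b"
| "points (Ray a b) = {a + \<rho> *\<^sub>R (b - a) | \<rho>. 0 \<le> \<rho>}"

fun end_points :: "line_object \<Rightarrow> point set" where
  "end_points (Segment a b) = {a, b}"
| "end_points (Ray a b) = {a}"

fun is_segment :: "line_object \<Rightarrow> bool" where
  "is_segment (Segment a b) \<longleftrightarrow> a \<noteq> b"
| "is_segment (Ray a b) \<longleftrightarrow> False"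

fun is_ray :: "line_object \<Rightarrow> bool" where
  "is_ray (Segment a b) \<longleftrightarrow> False"
| "is_ray (Ray a b) \<longleftrightarrow> a \<noteq> b"

definition interior_points :: "line_object \<Rightarrow> point set" where
  "interior_points l = points l - end_points l"

definition crosses :: "line_object \<Rightarrow> line_object \<Rightarrow> bool" where
  "crosses l\<^sub>1 l\<^sub>2 \<longleftrightarrow>
     (\<exists>p. points l\<^sub>1 \<inter> points l\<^sub>2 = {p} \<and> p \<notin> end_points l\<^sub>1 \<and> p \<notin> end_points l\<^sub>2)"


section \<open>Segment representations and compatibility\<close>

definition segment_representation :: "'a graph \<Rightarrow> ('a \<Rightarrow> line_object) \<Rightarrow> bool" where
  "segment_representation H s \<longleftrightarrow>
     (\<forall>u\<in>verts H. is_segment (s u)) \<and>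
     (\<forall>u\<in>verts H. \<forall>v\<in>verts H. u \<noteq> v \<longrightarrow>
        (points (s u) \<inter> points (s v) \<noteq> {} \<longleftrightarrow> {u, v} \<in> edges H))"

definition ray_from_to :: "line_object \<Rightarrow> line_object \<Rightarrow> line_object \<Rightarrow> bool" where
  "ray_from_to r s t \<longleftrightarrow>
     (\<exists>a\<in>interior_points s. \<exists>b\<in>end_points t.
        is_ray (Ray a b) \<and> r = Ray a b \<and> points r \<inter> (points s \<union> points t) = {a, b})"

text \<open>Rays are indexed by edges as unordered pairs, so that \<open>r\<^bsub>uv\<^esub> = r\<^bsub>vu\<^esub>\<close>.\<close>

definition compatible :: "('a \<Rightarrow> line_object) \<Rightarrow> 'a graph \<Rightarrow> bool" where
  "compatible s T \<longleftrightarrow>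
     (\<exists>r :: 'a set \<Rightarrow> line_object. \<forall>u v. {u, v} \<in> edges T \<longrightarrow>
        (ray_from_to (r {u, v}) (s u) (s v) \<or> ray_from_to (r {u, v}) (s v) (s u)) \<and>
        (\<forall>w\<in>verts T - {u, v}. crosses (r {u, v}) (s w)) \<and>
        (\<forall>e\<in>edges T - {{u, v}}. crosses (r {u, v}) (r e)))"

end

theory Submission
  imports Defs
begin

text \<open>Induction on the 2-tree. When a vertex \<open>v\<close> is attached to the edge \<open>xy\<close>, the ray \<open>r\<^bsub>xy\<^esub>\<close>
  crosses every segment and ray other than \<open>s\<^sub>x\<close> and \<open>s\<^sub>y\<close> transversally, so every segment or ray
  that is sufficiently close to it and long enough crosses them too. The segment \<open>s\<^sub>v\<close> is a slight
  tilt of a long initial piece of \<open>r\<^bsub>xy\<^esub>\<close>. Starting it just before or just after \<open>s\<^sub>x\<close>, and passing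
  the end-point of \<open>s\<^sub>y\<close> on one side or the other, gives any prescribed adjacency to \<open>x\<close> and \<open>y\<close>.
  The ray \<open>r\<^bsub>vx\<^esub>\<close> starts on \<open>s\<^sub>x\<close> and runs along \<open>r\<^bsub>xy\<^esub>\<close> through the far end of \<open>s\<^sub>v\<close>, while \<open>r\<^bsub>vy\<^esub>\<close>
  starts near the far end of \<open>s\<^sub>v\<close> and runs backwards through the end-point of \<open>s\<^sub>y\<close> and across \<open>s\<^sub>x\<close>.\<close>

section \<open>Transversal crossings and their stability\<close>

definition det2 :: "point \<Rightarrow> point \<Rightarrow> real" where
  "det2 p q = p $ 1 * q $ 2 - p $ 2 * q $ 1"

lemma det2_simps [simp]:
  "det2 (p + p') q = det2 p q + det2 p' q"
  "det2 p (q + q') = det2 p q + det2 p q'"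
  "det2 (p - p') q = det2 p q - det2 p' q"
  "det2 p (q - q') = det2 p q - det2 p q'"
  "det2 (k *\<^sub>R p) q = k * det2 p q"
  "det2 p (k *\<^sub>R q) = k * det2 p q"
  "det2 p p = 0" "det2 0 q = 0" "det2 p 0 = 0"
  by (auto simp: det2_def algebra_simps)

lemma det2_commute: "det2 p q = - det2 q p"
  by (simp add: det2_def algebra_simps)

lemma tendsto_det2 [tendsto_intros]:
  "(f \<longlongrightarrow> p) F \<Longrightarrow> (g \<longlongrightarrow> q) F \<Longrightarrow> ((\<lambda>x. det2 (f x) (g x)) \<longlongrightarrow> det2 p q) F"
  unfolding det2_def by (intro tendsto_intros)

text \<open>Cramer's rule in the basis \<open>u\<close>, \<open>w\<close>; multiplying through by
  \<open>D\<close> leaves a polynomial identity in the coordinates.\<close>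

lemma det2_decompose:
  assumes "det2 u w \<noteq> 0"
  shows "p = (det2 p w / det2 u w) *\<^sub>R u + (det2 u p / det2 u w) *\<^sub>R w"
proof -
  define D where "D = det2 u w"
  have "D *\<^sub>R p = D *\<^sub>R ((det2 p w / D) *\<^sub>R u + (det2 u p / D) *\<^sub>R w)"
    using assms unfolding D_def[symmetric]
    by (simp add: scaleR_add_right) (simp add: D_def vec_eq_iff forall_2 det2_def algebra_simps)
  then show ?thesis using assms unfolding D_def by simp
qed

lemma det2_zero_parallel:
  assumes "det2 u w = 0" "u \<noteq> 0"
  obtains k where "w = k *\<^sub>R u"
proof (cases "u $ 1 = 0")
  case True
  then have "u $ 2 \<noteq> 0" using assms(2) by (auto simp: vec_eq_iff forall_2)
  then have "w = (w $ 2 / u $ 2) *\<^sub>R u" using assms(1) True by (auto simp: vec_eq_iff forall_2 det2_def)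
  then show ?thesis by (rule that)
next
  case False
  then have "w = (w $ 1 / u $ 1) *\<^sub>R u"
    using assms(1) by (auto simp: vec_eq_iff forall_2 det2_def field_simps)
  then show ?thesis by (rule that)
qed

text \<open>Subtracting the two equations gives a multiple of \<open>e\<close> equal to a multiple
  of \<open>f\<close>; taking \<open>det2\<close> with \<open>f\<close> or with \<open>e\<close>
  kills one side.\<close>

lemma nonparallel_unique:
  assumes "det2 e f \<noteq> 0" "c + r *\<^sub>R e = d + t *\<^sub>R f" "c + r' *\<^sub>R e = d + t' *\<^sub>R f"
  shows "r = r'" "t = t'"
proof -
  have *: "(r - r') *\<^sub>R e = (t - t') *\<^sub>R f"
  proof -
    have "(c + r *\<^sub>R e) - (c + r' *\<^sub>R e) = (d + t *\<^sub>R f) - (d + t' *\<^sub>R f)"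
      by (simp only: assms(2,3))
    then show ?thesis by (simp add: algebra_simps)
  qed
  from arg_cong[OF *, of "\<lambda>p. det2 p f"] show "r = r'" using assms(1) by simp
  from arg_cong[OF *, of "\<lambda>p. det2 e p"] show "t = t'" using assms(1) by simp
qed

text \<open>Cramer's rule again. Explicit quotients are wanted because their limits can be computed
  when \<open>A\<close> and \<open>B\<close> move.\<close>

lemma line_intersection:
  assumes "det2 (B - A) f \<noteq> 0"
  shows "A + (det2 (c - A) f / det2 (B - A) f) *\<^sub>R (B - A)
       = c + (det2 (c - A) (B - A) / det2 (B - A) f) *\<^sub>R f"
proof -
  define D where "D = det2 (B - A) f"
  have "D *\<^sub>R (A + (det2 (c - A) f / D) *\<^sub>R (B - A)) = D *\<^sub>R (c + (det2 (c - A) (B - A) / D) *\<^sub>R f)"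
    using assms unfolding D_def[symmetric]
    by (simp add: scaleR_add_right) (simp add: D_def vec_eq_iff forall_2 det2_def algebra_simps)
  then show ?thesis using assms unfolding D_def by simp
qed

section \<open>Segments and rays under one parametrisation, the flag being \<open>True\<close> for
  rays\<close>

definition line_obj :: "bool \<Rightarrow> point \<Rightarrow> point \<Rightarrow> line_object" where
  "line_obj i a b = (if i then Ray a b else Segment a b)"

text \<open>These are the parameters of the points that are not end-points. The bound at 1 lapses
  for a ray, whose second defining point is not an end-point.\<close>

definition spans :: "bool \<Rightarrow> real \<Rightarrow> bool" where
  "spans i r \<longleftrightarrow> 0 < r \<and> (i \<or> r < 1)"

lemma points_line_obj:
  "points (line_obj i a b) = {a + r *\<^sub>R (b - a) | r. 0 \<le> r \<and> (i \<or> r \<le> 1)}"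
  by (auto simp: line_obj_def closed_segment_def algebra_simps)

lemma end_points_line_obj:
  "end_points (line_obj i a b) = (if i then {a} else {a, b})"
  by (auto simp: line_obj_def)

lemma not_end_point:
  assumes "spans i r" "a \<noteq> b"
  shows "a + r *\<^sub>R (b - a) \<notin> end_points (line_obj i a b)"
proof -
  have "a + r *\<^sub>R (b - a) \<noteq> b" if "r < 1"
  proof
    assume "a + r *\<^sub>R (b - a) = b"
    moreover have "(1 - r) *\<^sub>R (b - a) = b - (a + r *\<^sub>R (b - a))" by (simp add: algebra_simps)
    ultimately have "(1 - r) *\<^sub>R (b - a) = 0" by simp
    then show False using that assms(2) by simp
  qed
  then show ?thesis using assms by (auto simp: end_points_line_obj spans_def)
qed

lemma spans_if_not_end_point:
  assumes "0 \<le> r" "i \<or> r \<le> 1" "a + r *\<^sub>R (b - a) \<notin> end_points (line_obj i a b)"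
  shows "spans i r"
  using assms by (cases "r = 0"; cases "r = 1"; cases i) (auto simp: end_points_line_obj spans_def)

lemma interior_points_line_obj:
  assumes "spans i r" "a \<noteq> b"
  shows "a + r *\<^sub>R (b - a) \<in> interior_points (line_obj i a b)"
proof -
  have "a + r *\<^sub>R (b - a) \<in> points (line_obj i a b)"
    using assms(1) by (force simp: points_line_obj spans_def)
  then show ?thesis using not_end_point[OF assms] by (simp add: interior_points_def)
qed

lemma crosses_sym: "crosses l l' \<longleftrightarrow> crosses l' l"
  by (auto simp: crosses_def Int_commute)

lemma crossesI:
  assumes "det2 (b - a) (d - c) \<noteq> 0" "spans i r" "spans j t"
    and eq: "a + r *\<^sub>R (b - a) = c + t *\<^sub>R (d - c)"
  shows "crosses (line_obj i a b) (line_obj j c d)"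
proof -
  have ne: "a \<noteq> b" "c \<noteq> d" using assms(1) by auto
  have "points (line_obj i a b) \<inter> points (line_obj j c d) = {a + r *\<^sub>R (b - a)}"
  proof (intro equalityI subsetI)
    fix p assume "p \<in> points (line_obj i a b) \<inter> points (line_obj j c d)"
    then obtain r' t' where "p = a + r' *\<^sub>R (b - a)" "p = c + t' *\<^sub>R (d - c)"
      unfolding points_line_obj by blast
    with nonparallel_unique(1)[OF assms(1) eq, of r' t'] show "p \<in> {a + r *\<^sub>R (b - a)}" by auto
  next
    fix p assume "p \<in> {a + r *\<^sub>R (b - a)}"
    then show "p \<in> points (line_obj i a b) \<inter> points (line_obj j c d)"
      using interior_points_line_obj[OF assms(2) ne(1)] interior_points_line_obj[OF assms(3) ne(2)] eq
      by (simp add: interior_points_def)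
  qed
  then show ?thesis
    using not_end_point[OF assms(2) ne(1)] not_end_point[OF assms(3) ne(2)] eq
    unfolding crosses_def by auto
qed

text \<open>The object \<open>l\<close> meets the line \<open>a + \<real>u\<close> transversally at parameter \<open>t\<close>, in an interior
  point of \<open>l\<close>; unlike \<open>crosses\<close>, this is visibly stable under perturbation of the line.\<close>

definition hits :: "point \<Rightarrow> point \<Rightarrow> line_object \<Rightarrow> real \<Rightarrow> bool" where
  "hits a u l t \<longleftrightarrow> (\<exists>i c d r. l = line_obj i c d \<and> spans i r \<and>
     c + r *\<^sub>R (d - c) = a + t *\<^sub>R u \<and> det2 u (d - c) \<noteq> 0)"

text \<open>If the object were parallel to \<open>u\<close>, moving from \<open>p\<close> by
  \<open>x *\<^sub>R u\<close> would shift its parameter from \<open>r\<close> to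
  \<open>r + x / k\<close>. As \<open>r\<close> is strictly inside the range, small positive
  \<open>x\<close> would stay on the object.\<close>

lemma transversal_if_isolated:
  assumes "c \<noteq> d" "spans i r" "u \<noteq> 0" "c + r *\<^sub>R (d - c) = p" "0 < \<delta>"
    and no: "\<And>k. 0 < k \<Longrightarrow> k < \<delta> \<Longrightarrow> p + k *\<^sub>R u \<notin> points (line_obj i c d)"
  shows "det2 u (d - c) \<noteq> 0"
proof
  assume "det2 u (d - c) = 0"
  then obtain k where k: "d - c = k *\<^sub>R u" using det2_zero_parallel assms(3) by metis
  have "k \<noteq> 0" using k assms(1) by auto
  have "eventually (\<lambda>x. x < \<delta> \<and> 0 < r + x / k \<and> (i \<or> r + x / k < 1)) (at_right 0)"
  proof -
    have l: "((\<lambda>x. r + x / k) \<longlongrightarrow> r + 0 / k) (at_right 0)"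
      using \<open>k \<noteq> 0\<close> by (intro tendsto_intros)
    have "eventually (\<lambda>x. x < \<delta>) (at_right 0)"
      using \<open>0 < \<delta>\<close> by (rule eventually_at_right_real[THEN eventually_mono]) auto
    moreover have "eventually (\<lambda>x. 0 < r + x / k) (at_right 0)"
      using order_tendstoD(1)[OF l, of 0] assms(2) by (simp add: spans_def)
    moreover have "eventually (\<lambda>x. i \<or> r + x / k < 1) (at_right 0)"
      using order_tendstoD(2)[OF l, of 1] assms(2) by (cases i) (simp_all add: spans_def)
    ultimately show ?thesis by eventually_elim auto
  qed
  moreover have "eventually (\<lambda>x. 0 < x) (at_right (0::real))" by (rule eventually_at_right_less)
  ultimately have "eventually (\<lambda>x. 0 < x \<and> x < \<delta> \<and> 0 < r + x / k \<and> (i \<or> r + x / k < 1)) (at_right 0)"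
    by eventually_elim auto
  then obtain x where x: "0 < x" "x < \<delta>" "0 < r + x / k" "i \<or> r + x / k < 1"
    using eventually_happens'[OF trivial_limit_at_right_real] by blast
  have "p + x *\<^sub>R u = c + (r + x / k) *\<^sub>R (d - c)"
    using assms(4) k \<open>k \<noteq> 0\<close> by (simp add: algebra_simps)
  then have "p + x *\<^sub>R u \<in> points (line_obj i c d)" using x by (force simp: points_line_obj)
  then show False using no x by blast
qed

lemma is_line_objE:
  assumes "is_segment l \<or> is_ray l"
  obtains i c d where "l = line_obj i c d" "c \<noteq> d"
proof (cases l)
  case (Segment c d)
  with assms show ?thesis by (intro that[of False c d]) (auto simp: line_obj_def)
next
  case (Ray c d)
  with assms show ?thesis by (intro that[of True c d]) (auto simp: line_obj_def)
qed

text \<open>A crossing has only one common point, interior to both objects. A parallel object would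
  share further points with the ray, so the crossing is transversal.\<close>

lemma crosses_ray_hits:
  assumes "a \<noteq> b" "crosses (Ray a b) l" "is_segment l \<or> is_ray l"
  obtains t where "0 < t" "hits a (b - a) l t"
proof -
  obtain i c d where l: "l = line_obj i c d" "c \<noteq> d" using assms(3) is_line_objE by blast
  obtain p where p: "points (line_obj True a b) \<inter> points l = {p}"
      "p \<notin> end_points (line_obj True a b)" "p \<notin> end_points l"
    using assms(2) unfolding crosses_def line_obj_def by auto
  obtain t where t: "p = a + t *\<^sub>R (b - a)" "0 \<le> t" using p(1) unfolding points_line_obj by blast
  have "p \<in> points l" using p(1) by blast
  then obtain r where r: "p = c + r *\<^sub>R (d - c)" "0 \<le> r" "i \<or> r \<le> 1"
    unfolding l points_line_obj by blast
  have "0 < t" using spans_if_not_end_point[of t True a b] t p(2) by (auto simp: spans_def)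
  have s: "spans i r" using spans_if_not_end_point r p(3) unfolding l by blast
  have "det2 (b - a) (d - c) \<noteq> 0"
  proof (rule transversal_if_isolated[OF l(2) s _ r(1)[symmetric], of _ 1])
    fix k :: real assume k: "0 < k" "k < 1"
    have "p + k *\<^sub>R (b - a) = a + (t + k) *\<^sub>R (b - a)" by (simp add: t(1) algebra_simps)
    then have "p + k *\<^sub>R (b - a) \<in> points (line_obj True a b)"
      using k t(2) by (force simp: points_line_obj)
    moreover have "p + k *\<^sub>R (b - a) \<noteq> p" using k assms(1) by simp
    ultimately show "p + k *\<^sub>R (b - a) \<notin> points (line_obj i c d)" using p(1) l by blast
  qed (use assms(1) in auto)
  then have "hits a (b - a) l t" unfolding hits_def using l s r t by metis
  then show ?thesis using that \<open>0 < t\<close> by blast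
qed

section \<open>Perturbation of transversal crossings\<close>

lemma eventually_spans:
  assumes "(f \<longlongrightarrow> r) F" "spans i r"
  shows "eventually (\<lambda>x. spans i (f x)) F"
  using order_tendstoD[OF assms(1)] assms(2) unfolding spans_def
  by (cases i) (auto intro: eventually_conj)

text \<open>The quotients of \<open>line_intersection\<close> are continuous where the denominator
  is nonzero. Their limits are the position of \<open>t\<close> relative to \<open>t1\<close> and
  \<open>t2\<close>, and the unchanged parameter \<open>r\<close> on the fixed object.\<close>

lemma perturbed_intersection:
  assumes "c + r *\<^sub>R f = a + t *\<^sub>R u" "det2 u f \<noteq> 0" "t1 \<noteq> t2"
    and A: "(A \<longlongrightarrow> a + t1 *\<^sub>R u) F" and B: "(B \<longlongrightarrow> a + t2 *\<^sub>R u) F"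
  shows "eventually (\<lambda>x. det2 (B x - A x) f \<noteq> 0) F" (is ?E)
    and "((\<lambda>x. det2 (c - A x) f / det2 (B x - A x) f) \<longlongrightarrow> (t - t1) / (t2 - t1)) F" (is ?T1)
    and "((\<lambda>x. det2 (c - A x) (B x - A x) / det2 (B x - A x) f) \<longlongrightarrow> r) F" (is ?T2)
proof -
  have c: "c = a + t *\<^sub>R u - r *\<^sub>R f" using assms(1) by (simp add: algebra_simps)
  have D: "((\<lambda>x. det2 (B x - A x) f) \<longlongrightarrow> (t2 - t1) * det2 u f) F"
    by (rule tendsto_eq_rhs[OF tendsto_det2[OF tendsto_diff[OF B A] tendsto_const]])
      (simp add: algebra_simps)
  have ne: "(t2 - t1) * det2 u f \<noteq> 0" using assms by simp
  show ?E using tendsto_imp_eventually_ne[OF D ne] .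
  have N1: "((\<lambda>x. det2 (c - A x) f) \<longlongrightarrow> (t - t1) * det2 u f) F"
    by (rule tendsto_eq_rhs[OF tendsto_det2[OF tendsto_diff[OF tendsto_const A] tendsto_const]])
      (simp add: c algebra_simps)
  show ?T1 by (rule tendsto_eq_rhs[OF tendsto_divide[OF N1 D ne]]) (use assms in simp)
  have N2: "((\<lambda>x. det2 (c - A x) (B x - A x)) \<longlongrightarrow> r * ((t2 - t1) * det2 u f)) F"
    by (rule tendsto_eq_rhs[OF tendsto_det2[OF tendsto_diff[OF tendsto_const A] tendsto_diff[OF B A]]])
      (simp add: c algebra_simps det2_commute[of f u] det2_commute[of a u])
  show ?T2 by (rule tendsto_eq_rhs[OF tendsto_divide[OF N2 D ne]]) (use ne in simp)
qed

lemma eventually_crosses: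
  assumes "hits a u l t" "t1 \<noteq> t2" "spans i ((t - t1) / (t2 - t1))"
    and A: "(A \<longlongrightarrow> a + t1 *\<^sub>R u) F" and B: "(B \<longlongrightarrow> a + t2 *\<^sub>R u) F"
  shows "eventually (\<lambda>x. crosses (line_obj i (A x) (B x)) l) F"
proof -
  obtain j c d r where l: "l = line_obj j c d" "spans j r" and
      h: "c + r *\<^sub>R (d - c) = a + t *\<^sub>R u" "det2 u (d - c) \<noteq> 0"
    using assms(1) unfolding hits_def by blast
  note P = perturbed_intersection[OF h assms(2) A B]
  show ?thesis
    using P(1) eventually_spans[OF P(2) assms(3)] eventually_spans[OF P(3) l(2)]
  proof eventually_elim
    case (elim x)
    then show ?case unfolding l(1) using line_intersection[OF elim(1), of c] by (intro crossesI)
  qed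
qed

text \<open>The only candidate for a common point has, on the moving object, a parameter with limit
  \<open>(t - t1) / (t2 - t1) < 0\<close>, whereas points of the object have nonnegative
  parameters.\<close>

lemma eventually_disjoint:
  assumes "hits a u l t" "t < t1" "t1 < t2"
    and A: "(A \<longlongrightarrow> a + t1 *\<^sub>R u) F" and B: "(B \<longlongrightarrow> a + t2 *\<^sub>R u) F"
  shows "eventually (\<lambda>x. points (line_obj i (A x) (B x)) \<inter> points l = {}) F"
proof -
  obtain j c d r where l: "l = line_obj j c d" "spans j r" and
      h: "c + r *\<^sub>R (d - c) = a + t *\<^sub>R u" "det2 u (d - c) \<noteq> 0"
    using assms(1) unfolding hits_def by blast
  have "t1 \<noteq> t2" using assms by simp
  note P = perturbed_intersection[OF h this A B]
  have "(t - t1) / (t2 - t1) < 0" using assms by (simp add: divide_neg_pos)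
  from P(1) order_tendstoD(2)[OF P(2) this]
  show ?thesis
  proof eventually_elim
    case (elim x)
    show ?case
    proof (rule ccontr)
      assume "points (line_obj i (A x) (B x)) \<inter> points l \<noteq> {}"
      then obtain p where "p \<in> points (line_obj i (A x) (B x))" "p \<in> points (line_obj j c d)"
        unfolding l(1) by blast
      then obtain r' t' where "p = A x + r' *\<^sub>R (B x - A x)" "0 \<le> r'" "p = c + t' *\<^sub>R (d - c)"
        unfolding points_line_obj by blast
      with nonparallel_unique(1)[OF elim(1) line_intersection[OF elim(1), of c], of r' t'] elim(2)
      show False by auto
    qed
  qed
qed

text \<open>By non-parallelism the line of the ray meets the line of each segment once, and
  \<open>a\<close> and \<open>b\<close> already account for these meetings.\<close>

lemma ray_from_to_segmentsI:
  assumes "det2 (b - a) (B - A) \<noteq> 0" "det2 (b - a) (D - C) \<noteq> 0"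
    and "spans False r" "a = A + r *\<^sub>R (B - A)" "b \<in> {C, D}"
  shows "ray_from_to (Ray a b) (Segment A B) (Segment C D)"
proof -
  have ne: "a \<noteq> b" "A \<noteq> B" using assms by auto
  have ia: "a \<in> interior_points (Segment A B)"
    using interior_points_line_obj[OF assms(3) ne(2)] assms(4) by (simp add: line_obj_def)
  have "b \<in> points (Segment C D)" using assms(5) by auto
  have "points (Ray a b) \<inter> (points (Segment A B) \<union> points (Segment C D)) = {a, b}"
  proof (intro equalityI subsetI)
    fix p assume "p \<in> points (Ray a b) \<inter> (points (Segment A B) \<union> points (Segment C D))"
    then have p: "p \<in> points (line_obj True a b)"
        "p \<in> points (line_obj False A B) \<or> p \<in> points (line_obj False C D)"
      by (auto simp: line_obj_def)
    obtain k where k: "p = a + k *\<^sub>R (b - a)" using p(1) unfolding points_line_obj by blast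
    from p(2) show "p \<in> {a, b}"
    proof
      assume "p \<in> points (line_obj False A B)"
      then obtain m where "p = A + m *\<^sub>R (B - A)" unfolding points_line_obj by blast
      with nonparallel_unique(1)[OF assms(1), of a k A m 0 r] k assms(4) show ?thesis by simp
    next
      assume "p \<in> points (line_obj False C D)"
      then obtain m where m: "p = C + m *\<^sub>R (D - C)" unfolding points_line_obj by blast
      obtain m' where "b = C + m' *\<^sub>R (D - C)"
      proof -
        have "b = C + 0 *\<^sub>R (D - C) \<or> b = C + 1 *\<^sub>R (D - C)" using assms(5) by auto
        then show ?thesis using that by blast
      qed
      then have "k = 1" using nonparallel_unique(1)[OF assms(2), of a k C m 1 m'] k m by simp
      then show ?thesis using k by simp
    qed
  next
    fix p assume "p \<in> {a, b}"
    moreover have "a \<in> points (Ray a b)" "b \<in> points (Ray a b)"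
      by (auto intro: exI[of _ 0] exI[of _ 1])
    ultimately show "p \<in> points (Ray a b) \<inter> (points (Segment A B) \<union> points (Segment C D))"
      using ia \<open>b \<in> points (Segment C D)\<close> unfolding interior_points_def by blast
  qed
  then show ?thesis unfolding ray_from_to_def using ia assms(5) ne by auto
qed

section \<open>Adding a segment along a ray\<close>

text \<open>This is the point at abscissa \<open>t\<close> on the graph of the affine function
  \<open>\<alpha> + \<beta> * t\<close>, in the frame with origin \<open>a\<close>, axis
  \<open>u\<close> and vertical direction \<open>w\<close>.\<close>

definition graph_pt :: "point \<Rightarrow> point \<Rightarrow> point \<Rightarrow> real \<Rightarrow> real \<Rightarrow> real \<Rightarrow> point" where
  "graph_pt a u w \<alpha> \<beta> t = a + t *\<^sub>R u + (\<alpha> + \<beta> * t) *\<^sub>R w"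

lemma graph_pt_diff: "graph_pt a u w \<alpha> \<beta> t' - graph_pt a u w \<alpha> \<beta> t = (t' - t) *\<^sub>R (u + \<beta> *\<^sub>R w)"
  by (simp add: graph_pt_def algebra_simps)

lemma graph_pt_between:
  assumes "t \<noteq> t'"
  shows "graph_pt a u w \<alpha> \<beta> t + ((m - t) / (t' - t)) *\<^sub>R (graph_pt a u w \<alpha> \<beta> t' - graph_pt a u w \<alpha> \<beta> t)
    = graph_pt a u w \<alpha> \<beta> m"
proof -
  have "((m - t) / (t' - t)) *\<^sub>R (t' - t) *\<^sub>R (u + \<beta> *\<^sub>R w) = (m - t) *\<^sub>R (u + \<beta> *\<^sub>R w)"
    using assms by simp
  then show ?thesis unfolding graph_pt_diff by (simp only: graph_pt_def) (simp add: algebra_simps)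
qed

lemma graph_pt_cong: "\<alpha> + \<beta> * t = \<alpha>' + \<beta>' * t \<Longrightarrow> graph_pt a u w \<alpha> \<beta> t = graph_pt a u w \<alpha>' \<beta>' t"
  by (simp add: graph_pt_def)

lemma det2_graphs:
  assumes "det2 u w \<noteq> 0" "\<beta> \<noteq> \<beta>'" "t1 \<noteq> t2" "t1' \<noteq> t2'"
  shows "det2 (graph_pt a u w \<alpha> \<beta> t2 - graph_pt a u w \<alpha> \<beta> t1)
    (graph_pt a u w \<alpha>' \<beta>' t2' - graph_pt a u w \<alpha>' \<beta>' t1') \<noteq> 0"
proof -
  have "det2 (u + \<beta> *\<^sub>R w) (u + \<beta>' *\<^sub>R w) = (\<beta>' - \<beta>) * det2 u w"
    by (simp add: algebra_simps det2_commute[of w u])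
  then show ?thesis unfolding graph_pt_diff det2_simps(5,6) using assms by simp
qed

text \<open>Graphs of different slopes cross at the abscissa \<open>t\<close> where their heights
  agree, and parameters on the objects are affine in the abscissa.\<close>

lemma crosses_graphs:
  assumes "det2 u w \<noteq> 0" "\<beta> \<noteq> \<beta>'" "t1 \<noteq> t2" "t1' \<noteq> t2'" "\<alpha> + \<beta> * t = \<alpha>' + \<beta>' * t"
    and "spans i ((t - t1) / (t2 - t1))" "spans j ((t - t1') / (t2' - t1'))"
  shows "crosses (line_obj i (graph_pt a u w \<alpha> \<beta> t1) (graph_pt a u w \<alpha> \<beta> t2))
    (line_obj j (graph_pt a u w \<alpha>' \<beta>' t1') (graph_pt a u w \<alpha>' \<beta>' t2'))"
  by (rule crossesI[OF det2_graphs[OF assms(1-4)] assms(6,7)])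
    (simp only: graph_pt_between[OF assms(3)] graph_pt_between[OF assms(4)] graph_pt_cong[OF assms(5)])

lemma tendsto_graph_pt:
  assumes "(f \<longlongrightarrow> 0) F" "(g \<longlongrightarrow> 0) F"
  shows "((\<lambda>x. graph_pt a u w (f x) (g x) t) \<longlongrightarrow> a + t *\<^sub>R u) F"
  unfolding graph_pt_def by (rule tendsto_eq_intros assms refl | simp)+

text \<open>Inserting 1 into the set of values covers an empty \<open>L\<close> and also puts the
  abscissa 1 of \<open>b\<close> between the bounds.\<close>

lemma finite_positive_bounds:
  fixes f :: "'b \<Rightarrow> real"
  assumes "finite L" "\<And>l. l \<in> L \<Longrightarrow> 0 < f l"
  obtains m M where "0 < m" "m < 1" "1 < M" "\<And>l. l \<in> L \<Longrightarrow> m < f l \<and> f l < M"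
proof
  let ?S = "insert 1 (f ` L)"
  have fin: "finite ?S" "?S \<noteq> {}" using assms by auto
  have "0 < Min ?S" using assms by (subst Min_gr_iff[OF fin]) auto
  then show "0 < Min ?S / 2" by simp
  have "x \<in> ?S \<Longrightarrow> Min ?S \<le> x \<and> x \<le> Max ?S" for x using fin by simp
  then have *: "Min ?S \<le> 1" "1 \<le> Max ?S" "\<And>l. l \<in> L \<Longrightarrow> Min ?S \<le> f l \<and> f l \<le> Max ?S" by auto
  show "Min ?S / 2 < 1" "1 < Max ?S + 1" using * by linarith+
  show "Min ?S / 2 < f l \<and> f l < Max ?S + 1" if "l \<in> L" for l
    using *(3)[OF that] \<open>0 < Min ?S\<close> by linarith
qed

text \<open>The given ray runs along the axis of the frame \<open>(a, u = b - a, w = C - b)\<close>, in which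
  \<open>Segment b C\<close> stands on the axis at abscissa 1 and \<open>Segment A B\<close> crosses it at abscissa 0; all
  objects of \<open>L\<close> cross it at abscissas in \<open>(m, M)\<close>. Up to the factor \<open>\<epsilon>\<close>, the three new objects
  have the following heights at abscissa \<open>t\<close>:
  \<^item> the segment: \<open>\<sigma> (M + 1 - t)\<close> for \<open>t\<close> between \<open>p0 = \<plusminus>m\<close> and \<open>M + 2\<close>. The sign of \<open>p0\<close>
    decides whether it meets \<open>Segment A B\<close>, and \<open>\<sigma> = \<plusminus>1\<close> whether it meets \<open>Segment b C\<close>;
  \<^item> the ray \<open>rx\<close>: \<open>\<sigma> k (c - t)\<close>, from \<open>Segment A B\<close> to the right, through the right end of the
    new segment. The sign of \<open>c - 1\<close> is that of \<open>\<sigma>\<close>, so that it passes above \<open>b\<close>;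
  \<^item> the ray \<open>ry\<close>: \<open>\<sigma> j (t - 1)\<close>, from the point of the new segment at \<open>t = M\<close> to the left,
    through \<open>b\<close>. It crosses \<open>rx\<close> at \<open>t0\<close>, which lies between \<open>c\<close> and 1.

  Crossings with \<open>L\<close> and \<open>Segment A B\<close> persist from \<open>\<epsilon> = 0\<close>; the others are computed exactly.\<close>

lemma extend_along_ray:
  fixes X Y :: bool
  assumes "spans False \<mu>" "a = A + \<mu> *\<^sub>R (B - A)"
    and detx: "det2 (b - a) (B - A) \<noteq> 0" and dety: "det2 (b - a) (C - b) \<noteq> 0"
    and "finite L" and hitsL: "\<forall>l\<in>L. \<exists>t>0. hits a (b - a) l t"
  shows "\<exists>sv rx ry. is_segment sv \<and>
    (points sv \<inter> points (Segment A B) \<noteq> {} \<longleftrightarrow> X) \<and> (points sv \<inter> points (Segment b C) \<noteq> {} \<longleftrightarrow> Y) \<and>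
    ray_from_to rx (Segment A B) sv \<and> ray_from_to ry sv (Segment b C) \<and>
    crosses rx (Segment b C) \<and> crosses ry (Segment A B) \<and>
    crosses (Ray a b) sv \<and> crosses (Ray a b) rx \<and> crosses (Ray a b) ry \<and> crosses rx ry \<and>
    (\<forall>l\<in>L. crosses sv l \<and> crosses rx l \<and> crosses ry l)"
proof -
  define u w e where "u = b - a" and "w = C - b" and "e = B - A"
  have uw: "det2 u w \<noteq> 0" and ue: "det2 u e \<noteq> 0" using detx dety by (auto simp: u_def w_def e_def)
  obtain e1 e2 where e: "e = e1 *\<^sub>R u + e2 *\<^sub>R w" using det2_decompose[OF uw] by blast
  \<comment> \<open>\<open>Segment A B\<close> is not parallel to the axis, so its direction has a
    vertical component.\<close>
  have "e2 \<noteq> 0" using ue unfolding e by auto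
  obtain \<tau> where \<tau>: "\<And>l. l \<in> L \<Longrightarrow> 0 < \<tau> l" "\<And>l. l \<in> L \<Longrightarrow> hits a u l (\<tau> l)"
    using hitsL unfolding u_def by metis
  obtain m M where m: "0 < m" "m < 1" "1 < M" "\<And>l. l \<in> L \<Longrightarrow> m < \<tau> l \<and> \<tau> l < M"
    using finite_positive_bounds[of L \<tau>] \<tau>(1) \<open>finite L\<close> by blast
  define \<sigma> :: real where "\<sigma> = (if Y then 1 else - 1)"
  define c where "c = (if Y then M else 1 / 2)"
  define p0 where "p0 = (if X then - m else m)"
  \<comment> \<open>\<open>k\<close> gives \<open>rx\<close> the height of the new segment at
    \<open>M + 2\<close>, namely \<open>- \<sigma>\<close>; \<open>j\<close> gives \<open>ry\<close>
    its height at \<open>M\<close>, namely \<open>\<sigma>\<close> (both up to the factor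
    \<open>\<epsilon>\<close>).\<close>
  define j k where "j = 1 / (M - 1)" and "k = 1 / (M + 2 - c)"
  have c: "0 < c" "c \<le> M" "c \<noteq> 1" "0 < \<sigma> * (c - 1)" and \<sigma>: "\<sigma> \<noteq> 0"
    using m by (auto simp: c_def \<sigma>_def)
  have k: "0 < k" "k < 1" "k * (M + 2 - c) = 1" using c by (auto simp: k_def)
  have j: "0 < j" "j * (M - 1) = 1" using m by (auto simp: j_def)
  have p0: "p0 < M" "p0 < 1" "\<And>l. l \<in> L \<Longrightarrow> p0 < \<tau> l" using m by (auto simp: p0_def) (smt (verit) m)+
  \<comment> \<open>Solution of \<open>j * (t - 1) = k * (c - t)\<close>: the average of 1 and
    \<open>c\<close> with weights \<open>j\<close> and \<open>k\<close>.\<close>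
  define t0 where "t0 = (j + k * c) / (j + k)"
  have t0: "0 < t0" "t0 < M" "j * (t0 - 1) = k * (c - t0)"
  proof -
    show "0 < t0" using c k j unfolding t0_def by (simp add: add_pos_pos)
    have "j + k * c < j * M + k * M" using c k j m by (intro add_less_le_mono) simp_all
    then show "t0 < M" unfolding t0_def using j k by (simp add: pos_divide_less_eq algebra_simps)
    have "t0 * (j + k) = j + k * c" unfolding t0_def using j k by simp
    then show "j * (t0 - 1) = k * (c - t0)" by (simp add: algebra_simps)
  qed

  define V where "V \<epsilon> t = graph_pt a u w (\<epsilon> * (\<sigma> * (M + 1))) (\<epsilon> * - \<sigma>) t" for \<epsilon> t
  define Rx where "Rx \<epsilon> t = graph_pt a u w (\<epsilon> * (\<sigma> * k * c)) (\<epsilon> * (- \<sigma> * k)) t" for \<epsilon> t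
  define Ry where "Ry \<epsilon> t = graph_pt a u w (\<epsilon> * (- \<sigma> * j)) (\<epsilon> * (\<sigma> * j)) t" for \<epsilon> t
  \<comment> \<open>The line \<open>a + \<kappa> *\<^sub>R e\<close> has abscissa
    \<open>\<kappa> * e1\<close> and height \<open>\<kappa> * e2\<close>; this
    \<open>\<kappa>\<close> puts the point on the graph \<open>Rx \<epsilon>\<close>, and it becomes
    the starting point of \<open>rx\<close>.\<close>
  define \<kappa> where "\<kappa> \<epsilon> = \<epsilon> * (\<sigma> * k * c) / (e2 - \<epsilon> * (- \<sigma> * k) * e1)" for \<epsilon>
  have q: "V \<epsilon> (M + 2) = Rx \<epsilon> (M + 2)" for \<epsilon>
    unfolding V_def Rx_def
  proof (rule graph_pt_cong)
    have "\<epsilon> * (\<sigma> * k * c) + \<epsilon> * (- \<sigma> * k) * (M + 2) = - \<epsilon> * \<sigma> * (k * (M + 2 - c))" by (simp add: algebra_simps)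
    then show "\<epsilon> * (\<sigma> * (M + 1)) + \<epsilon> * - \<sigma> * (M + 2) = \<epsilon> * (\<sigma> * k * c) + \<epsilon> * (- \<sigma> * k) * (M + 2)"
      unfolding k(3) by (simp add: algebra_simps)
  qed
  have yM: "V \<epsilon> M = Ry \<epsilon> M" for \<epsilon>
    unfolding V_def Ry_def
  proof (rule graph_pt_cong)
    have "\<epsilon> * (- \<sigma> * j) + \<epsilon> * (\<sigma> * j) * M = \<epsilon> * \<sigma> * (j * (M - 1))" by (simp add: algebra_simps)
    then show "\<epsilon> * (\<sigma> * (M + 1)) + \<epsilon> * - \<sigma> * M = \<epsilon> * (- \<sigma> * j) + \<epsilon> * (\<sigma> * j) * M"
      unfolding j(2) by (simp add: algebra_simps)
  qed
  have y1: "Ry \<epsilon> 1 = b" for \<epsilon> by (simp add: Ry_def graph_pt_def u_def)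
  have ray: "Ray a b = line_obj True (graph_pt a u w 0 0 0) (graph_pt a u w 0 0 1)"
    by (simp add: line_obj_def graph_pt_def u_def)
  have hx: "hits a u (Segment A B) 0"
    unfolding hits_def using assms(1,2) ue unfolding e_def
    by (intro exI[of _ False] exI[of _ A] exI[of _ B] exI[of _ \<mu>]) (simp add: line_obj_def)

  have id: "((\<lambda>\<epsilon>. \<epsilon> * z) \<longlongrightarrow> 0) (at_right 0)" for z :: real
    by (rule tendsto_eq_intros refl | simp)+
  have tV: "((\<lambda>\<epsilon>. V \<epsilon> t) \<longlongrightarrow> a + t *\<^sub>R u) (at_right 0)" for t
    unfolding V_def by (rule tendsto_graph_pt id)+
  have tRx: "((\<lambda>\<epsilon>. Rx \<epsilon> t) \<longlongrightarrow> a + t *\<^sub>R u) (at_right 0)" for t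
    unfolding Rx_def by (rule tendsto_graph_pt id)+
  have tRy: "((\<lambda>\<epsilon>. Ry \<epsilon> t) \<longlongrightarrow> a + t *\<^sub>R u) (at_right 0)" for t
    unfolding Ry_def by (rule tendsto_graph_pt id)+
  have t\<kappa>d: "((\<lambda>\<epsilon>. e2 - \<epsilon> * (- \<sigma> * k) * e1) \<longlongrightarrow> e2) (at_right 0)"
    by (rule tendsto_eq_intros refl | simp)+
  have t\<kappa>: "(\<kappa> \<longlongrightarrow> 0) (at_right 0)"
    unfolding \<kappa>_def using tendsto_divide[OF id t\<kappa>d \<open>e2 \<noteq> 0\<close>] by simp
  have tS: "((\<lambda>\<epsilon>. a + \<kappa> \<epsilon> *\<^sub>R e) \<longlongrightarrow> a + 0 *\<^sub>R u) (at_right 0)"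
    by (rule tendsto_eq_intros t\<kappa> refl | simp)+
  have ts: "((\<lambda>\<epsilon>. \<kappa> \<epsilon> * e1) \<longlongrightarrow> 0) (at_right 0)"
    by (rule tendsto_eq_intros t\<kappa> refl | simp)+

  \<comment> \<open>In the limit all three objects lie on the axis, and it suffices that each
    abscissa \<open>\<tau> l\<close> lies strictly within their extents: \<open>p0\<close> to
    \<open>M + 2\<close>, from 0 to the right, and from \<open>M\<close> to the left. The start of
    \<open>rx\<close> is written with \<open>\<kappa>\<close> because its abscissa depends on
    \<open>\<epsilon>\<close>.\<close>
  have evL: "eventually (\<lambda>\<epsilon>. \<forall>l\<in>L.
      crosses (line_obj False (V \<epsilon> p0) (V \<epsilon> (M + 2))) l \<and>
      crosses (line_obj True (a + \<kappa> \<epsilon> *\<^sub>R e) (Rx \<epsilon> (M + 2))) l \<and>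
      crosses (line_obj True (Ry \<epsilon> M) (Ry \<epsilon> 1)) l) (at_right 0)"
  proof (intro eventually_ball_finite[OF \<open>finite L\<close>] ballI eventually_conj)
    fix l assume l: "l \<in> L"
    show "eventually (\<lambda>\<epsilon>. crosses (line_obj False (V \<epsilon> p0) (V \<epsilon> (M + 2))) l) (at_right 0)"
      by (rule eventually_crosses[OF \<tau>(2)[OF l] _ _ tV tV])
        (use m(4)[OF l] p0(1) p0(3)[OF l] m in \<open>auto simp: spans_def divide_simps\<close>)
    show "eventually (\<lambda>\<epsilon>. crosses (line_obj True (a + \<kappa> \<epsilon> *\<^sub>R e) (Rx \<epsilon> (M + 2))) l) (at_right 0)"
      by (rule eventually_crosses[OF \<tau>(2)[OF l] _ _ tS tRx])
        (use m(4)[OF l] m in \<open>auto simp: spans_def divide_simps\<close>)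
    show "eventually (\<lambda>\<epsilon>. crosses (line_obj True (Ry \<epsilon> M) (Ry \<epsilon> 1)) l) (at_right 0)"
      by (rule eventually_crosses[OF \<tau>(2)[OF l] _ _ tRy tRy])
        (use m(4)[OF l] m in \<open>auto simp: spans_def divide_simps\<close>)
  qed
  have evy: "eventually (\<lambda>\<epsilon>. crosses (line_obj True (Ry \<epsilon> M) (Ry \<epsilon> 1)) (Segment A B)) (at_right 0)"
    by (rule eventually_crosses[OF hx _ _ tRy tRy]) (use m in \<open>auto simp: spans_def divide_simps\<close>)
  have evx: "eventually (\<lambda>\<epsilon>. points (line_obj False (V \<epsilon> p0) (V \<epsilon> (M + 2))) \<inter> points (Segment A B) \<noteq> {} \<longleftrightarrow> X) (at_right 0)"
  proof (cases X)
    case True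
    have "eventually (\<lambda>\<epsilon>. crosses (line_obj False (V \<epsilon> p0) (V \<epsilon> (M + 2))) (Segment A B)) (at_right 0)"
      by (rule eventually_crosses[OF hx _ _ tV tV])
        (use m True in \<open>auto simp: spans_def divide_simps p0_def\<close>)
    then show ?thesis by eventually_elim (use True in \<open>auto simp: crosses_def\<close>)
  next
    case False
    have "eventually (\<lambda>\<epsilon>. points (line_obj False (V \<epsilon> p0) (V \<epsilon> (M + 2))) \<inter> points (Segment A B) = {}) (at_right 0)"
      by (rule eventually_disjoint[OF hx _ _ tV tV]) (use m False in \<open>auto simp: p0_def\<close>)
    then show ?thesis by eventually_elim (use False in auto)
  qed
  have evd: "eventually (\<lambda>\<epsilon>. det2 (u + (\<epsilon> * (- \<sigma> * k)) *\<^sub>R w) e \<noteq> 0) (at_right 0)"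
  proof -
    have "((\<lambda>\<epsilon>. det2 (u + (\<epsilon> * (- \<sigma> * k)) *\<^sub>R w) e) \<longlongrightarrow> det2 (u + 0 *\<^sub>R w) e) (at_right 0)"
      by (rule tendsto_intros id)+
    then show ?thesis by (rule tendsto_imp_eventually_ne) (use ue in simp)
  qed
  have ev\<mu>: "eventually (\<lambda>\<epsilon>. spans False (\<mu> + \<kappa> \<epsilon>)) (at_right 0)"
    by (rule eventually_spans[OF _ assms(1)]) (rule tendsto_eq_intros t\<kappa> refl | simp)+
  \<comment> \<open>Used with \<open>z\<close> equal to \<open>c\<close>, 1 and \<open>t0\<close>:
    \<open>rx\<close> must start to the left of its meetings with the axis, with
    \<open>Segment b C\<close> and with \<open>ry\<close>.\<close>
  have evt: "eventually (\<lambda>\<epsilon>. \<kappa> \<epsilon> * e1 < z) (at_right 0)" if "0 < z" for z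
    using order_tendstoD(2)[OF ts that] .
  \<comment> \<open>Keeps the heights of the new segment and of \<open>rx\<close> at abscissa 1
    below that of \<open>C\<close>, which is 1.\<close>
  have evs: "eventually (\<lambda>\<epsilon>. \<epsilon> * z < 1) (at_right 0)" for z :: real
    using order_tendstoD(2)[OF id, of 1] by simp
  have ev0: "eventually (\<lambda>\<epsilon>. 0 < \<epsilon>) (at_right (0::real))" by (rule eventually_at_right_less)
  have "eventually (\<lambda>\<epsilon>. (\<forall>l\<in>L.
      crosses (line_obj False (V \<epsilon> p0) (V \<epsilon> (M + 2))) l \<and>
      crosses (line_obj True (a + \<kappa> \<epsilon> *\<^sub>R e) (Rx \<epsilon> (M + 2))) l \<and>
      crosses (line_obj True (Ry \<epsilon> M) (Ry \<epsilon> 1)) l) \<and>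
      crosses (line_obj True (Ry \<epsilon> M) (Ry \<epsilon> 1)) (Segment A B) \<and>
      (points (line_obj False (V \<epsilon> p0) (V \<epsilon> (M + 2))) \<inter> points (Segment A B) \<noteq> {} \<longleftrightarrow> X) \<and>
      det2 (u + (\<epsilon> * (- \<sigma> * k)) *\<^sub>R w) e \<noteq> 0 \<and> spans False (\<mu> + \<kappa> \<epsilon>) \<and>
      e2 - \<epsilon> * (- \<sigma> * k) * e1 \<noteq> 0 \<and>
      \<kappa> \<epsilon> * e1 < c \<and> \<kappa> \<epsilon> * e1 < 1 \<and> \<kappa> \<epsilon> * e1 < t0 \<and>
      \<epsilon> * (\<sigma> * k * (c - 1)) < 1 \<and> \<epsilon> * M < 1 \<and> 0 < \<epsilon>) (at_right 0)"
    using c t0 by (intro eventually_conj evL evy evx evd ev\<mu> evt evs ev0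
        tendsto_imp_eventually_ne[OF t\<kappa>d \<open>e2 \<noteq> 0\<close>]) auto
  then obtain \<epsilon> where \<epsilon>L: "\<forall>l\<in>L.
      crosses (line_obj False (V \<epsilon> p0) (V \<epsilon> (M + 2))) l \<and>
      crosses (line_obj True (a + \<kappa> \<epsilon> *\<^sub>R e) (Rx \<epsilon> (M + 2))) l \<and>
      crosses (line_obj True (Ry \<epsilon> M) (Ry \<epsilon> 1)) l"
    and \<epsilon>y: "crosses (line_obj True (Ry \<epsilon> M) (Ry \<epsilon> 1)) (Segment A B)"
    and \<epsilon>x: "points (line_obj False (V \<epsilon> p0) (V \<epsilon> (M + 2))) \<inter> points (Segment A B) \<noteq> {} \<longleftrightarrow> X"
    and \<epsilon>d: "det2 (u + (\<epsilon> * (- \<sigma> * k)) *\<^sub>R w) e \<noteq> 0" and \<epsilon>\<mu>: "spans False (\<mu> + \<kappa> \<epsilon>)"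
    and \<epsilon>e: "e2 - \<epsilon> * (- \<sigma> * k) * e1 \<noteq> 0"
    and \<epsilon>t: "\<kappa> \<epsilon> * e1 < c" "\<kappa> \<epsilon> * e1 < 1" "\<kappa> \<epsilon> * e1 < t0"
    and \<epsilon>1: "\<epsilon> * (\<sigma> * k * (c - 1)) < 1" "\<epsilon> * M < 1" and "0 < \<epsilon>"
    using eventually_happens'[OF trivial_limit_at_right_real] by blast

  define ts where "ts = \<kappa> \<epsilon> * e1"
  have S: "a + \<kappa> \<epsilon> *\<^sub>R e = Rx \<epsilon> ts"
  proof -
    have "\<kappa> \<epsilon> * (e2 - \<epsilon> * (- \<sigma> * k) * e1) = \<epsilon> * (\<sigma> * k * c)"
      unfolding \<kappa>_def using \<epsilon>e by simp
    then have "\<kappa> \<epsilon> * e2 = \<epsilon> * (\<sigma> * k * c) + \<epsilon> * (- \<sigma> * k) * ts"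
      by (simp add: ts_def algebra_simps)
    then have "Rx \<epsilon> ts = a + ts *\<^sub>R u + (\<kappa> \<epsilon> * e2) *\<^sub>R w" by (simp add: Rx_def graph_pt_def)
    then show ?thesis by (simp add: e ts_def scaleR_add_right add.assoc)
  qed
  define sv rx ry where "sv = line_obj False (V \<epsilon> p0) (V \<epsilon> (M + 2))"
    and "rx = line_obj True (Rx \<epsilon> ts) (Rx \<epsilon> (M + 2))" and "ry = line_obj True (Ry \<epsilon> M) (Ry \<epsilon> 1)"
  have ts: "ts < c" "ts < 1" "ts < t0" "ts < M + 2" using \<epsilon>t m by (auto simp: ts_def)
  have sy: "Segment b C = line_obj False b C" by (simp add: line_obj_def)
  have C: "C - b = w" by (simp add: w_def)
  have dw: "det2 (graph_pt a u w \<alpha> \<beta> t' - graph_pt a u w \<alpha> \<beta> t) w \<noteq> 0" if "t \<noteq> t'" for \<alpha> \<beta> t t'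
    unfolding graph_pt_diff using that uw by simp
  have at1: "graph_pt a u w \<alpha> \<beta> 1 = b + (\<alpha> + \<beta>) *\<^sub>R w" for \<alpha> \<beta>
    by (simp add: graph_pt_def u_def)

  have r2: "points sv \<inter> points (Segment A B) \<noteq> {} \<longleftrightarrow> X" using \<epsilon>x by (simp add: sv_def)
  have V1: "V \<epsilon> 1 = b + (\<epsilon> * \<sigma> * M) *\<^sub>R (C - b)"
    unfolding V_def at1 C by (simp add: algebra_simps)
  have ne: "p0 \<noteq> M + 2" using p0(1) by simp
  have V1': "V \<epsilon> p0 + ((1 - p0) / (M + 2 - p0)) *\<^sub>R (V \<epsilon> (M + 2) - V \<epsilon> p0) = V \<epsilon> 1"
    unfolding V_def by (rule graph_pt_between[OF ne])
  have dVw: "det2 (V \<epsilon> (M + 2) - V \<epsilon> p0) (C - b) \<noteq> 0" unfolding V_def C by (rule dw[OF ne])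
  have r1: "is_segment sv" using dVw by (auto simp: sv_def line_obj_def)
  have r3: "points sv \<inter> points (Segment b C) \<noteq> {} \<longleftrightarrow> Y"
  proof (cases Y)
    case True
    have "crosses sv (Segment b C)"
      unfolding sv_def sy
      by (rule crossesI[OF dVw _ _ V1'[unfolded V1]])
        (use True \<open>0 < \<epsilon>\<close> \<epsilon>1(2) m p0 in \<open>auto simp: spans_def \<sigma>_def divide_simps\<close>)
    then show ?thesis using True by (auto simp: crosses_def)
  next
    \<comment> \<open>Now \<open>\<sigma> = - 1\<close>, so the new segment passes abscissa 1 at
      height \<open>- \<epsilon> * M\<close>, below \<open>b\<close>.\<close>
    case False
    have "False" if p: "p \<in> points sv" "p \<in> points (line_obj False b C)" for p
    proof -
      obtain r' where r': "p = V \<epsilon> p0 + r' *\<^sub>R (V \<epsilon> (M + 2) - V \<epsilon> p0)"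
        using p(1) unfolding sv_def points_line_obj by blast
      obtain t' where t': "p = b + t' *\<^sub>R (C - b)" "0 \<le> t'"
        using p(2) unfolding points_line_obj by blast
      have "t' = \<epsilon> * \<sigma> * M"
        using nonparallel_unique(2)[OF dVw _ V1'[unfolded V1], of r' t'] r' t' by simp
      moreover have "\<epsilon> * M > 0" using \<open>0 < \<epsilon>\<close> m by simp
      ultimately show False using t'(2) False by (simp add: \<sigma>_def)
    qed
    then show ?thesis using False unfolding sy by blast
  qed
  have S\<mu>: "Rx \<epsilon> ts = A + (\<mu> + \<kappa> \<epsilon>) *\<^sub>R (B - A)"
    unfolding S[symmetric] e_def by (simp add: assms(2) algebra_simps)
  have sl: "\<epsilon> * (\<sigma> * x) \<noteq> \<epsilon> * (\<sigma> * y)" if "x \<noteq> y" for x y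
    using that \<open>0 < \<epsilon>\<close> \<sigma> by simp
  \<comment> \<open>Up to the factor \<open>\<epsilon> * \<sigma>\<close> the slopes are
    \<open>- 1 < - k < 0 < j\<close>, so no two of the new segment, \<open>rx\<close>,
    \<open>ry\<close> and the axis are parallel.\<close>
  have slopes: "\<epsilon> * - \<sigma> \<noteq> \<epsilon> * (- \<sigma> * k)" "\<epsilon> * - \<sigma> \<noteq> \<epsilon> * (\<sigma> * j)" "\<epsilon> * (- \<sigma> * k) \<noteq> \<epsilon> * (\<sigma> * j)"
      "\<epsilon> * - \<sigma> \<noteq> 0" "\<epsilon> * (- \<sigma> * k) \<noteq> 0" "\<epsilon> * (\<sigma> * j) \<noteq> 0"
    using sl[of "- 1" "- k"] sl[of "- 1" j] sl[of "- k" j] sl[of "- 1" 0] sl[of "- k" 0] sl[of j 0] k j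
    by simp_all
  note dg = det2_graphs[OF uw]
  have r4: "ray_from_to rx (Segment A B) sv"
    unfolding rx_def sv_def line_obj_def if_True if_False
  proof (rule ray_from_to_segmentsI[OF _ _ \<epsilon>\<mu> S\<mu>])
    show "det2 (Rx \<epsilon> (M + 2) - Rx \<epsilon> ts) (B - A) \<noteq> 0"
      unfolding Rx_def graph_pt_diff det2_simps(5) using \<epsilon>d ts(4) unfolding e_def
      by (metis diff_gt_0_iff_gt less_irrefl mult_eq_0_iff)
    show "det2 (Rx \<epsilon> (M + 2) - Rx \<epsilon> ts) (V \<epsilon> (M + 2) - V \<epsilon> p0) \<noteq> 0"
      unfolding Rx_def V_def using slopes(1) ts(4) ne by (intro dg) auto
  qed (simp add: q)
  have r5: "ray_from_to ry sv (Segment b C)"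
    unfolding ry_def sv_def line_obj_def if_True if_False
  proof (rule ray_from_to_segmentsI)
    show "det2 (Ry \<epsilon> 1 - Ry \<epsilon> M) (V \<epsilon> (M + 2) - V \<epsilon> p0) \<noteq> 0"
      unfolding Ry_def V_def using slopes(2) m ne by (intro dg) auto
    show "det2 (Ry \<epsilon> 1 - Ry \<epsilon> M) (C - b) \<noteq> 0"
      unfolding Ry_def C using m by (intro dw) auto
    show "spans False ((M - p0) / (M + 2 - p0))" using p0(1) by (auto simp: spans_def divide_simps)
    show "Ry \<epsilon> M = V \<epsilon> p0 + ((M - p0) / (M + 2 - p0)) *\<^sub>R (V \<epsilon> (M + 2) - V \<epsilon> p0)"
      unfolding yM[symmetric] unfolding V_def by (rule graph_pt_between[OF ne, symmetric])
  qed (simp add: y1)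
  have r6: "crosses rx (Segment b C)"
    unfolding rx_def sy
  proof (rule crossesI)
    show "det2 (Rx \<epsilon> (M + 2) - Rx \<epsilon> ts) (C - b) \<noteq> 0"
      unfolding Rx_def C using ts(4) by (intro dw) auto
    show "spans True ((1 - ts) / (M + 2 - ts))" using ts(2,4) by (auto simp: spans_def)
    have "0 < \<epsilon> * (k * (\<sigma> * (c - 1)))" using \<open>0 < \<epsilon>\<close> k c by simp
    then show "spans False (\<epsilon> * (\<sigma> * k * (c - 1)))"
      using \<epsilon>1(1) by (auto simp: spans_def mult_ac)
    have "Rx \<epsilon> 1 = b + (\<epsilon> * (\<sigma> * k * (c - 1))) *\<^sub>R (C - b)"
      unfolding Rx_def at1 C by (simp add: algebra_simps)
    moreover have "Rx \<epsilon> ts + ((1 - ts) / (M + 2 - ts)) *\<^sub>R (Rx \<epsilon> (M + 2) - Rx \<epsilon> ts) = Rx \<epsilon> 1"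
      unfolding Rx_def using ts(4) by (intro graph_pt_between) auto
    ultimately show "Rx \<epsilon> ts + ((1 - ts) / (M + 2 - ts)) *\<^sub>R (Rx \<epsilon> (M + 2) - Rx \<epsilon> ts)
      = b + (\<epsilon> * (\<sigma> * k * (c - 1))) *\<^sub>R (C - b)" by simp
  qed
  have r7: "crosses ry (Segment A B)" using \<epsilon>y by (simp add: ry_def)
  have r8: "crosses (Ray a b) sv"
    unfolding ray sv_def V_def
    by (rule crosses_graphs[OF uw, where t = "M + 1"])
      (use slopes(4) ne p0 m in \<open>auto simp: spans_def divide_simps algebra_simps\<close>)
  have r9: "crosses (Ray a b) rx"
    unfolding ray rx_def Rx_def
    by (rule crosses_graphs[OF uw, where t = c])
      (use slopes(5) ts c in \<open>auto simp: spans_def divide_simps algebra_simps\<close>)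
  \<comment> \<open>The crossing point is \<open>b\<close> itself, which defines both rays but is an
    end-point of neither.\<close>
  have r10: "crosses (Ray a b) ry"
    unfolding ray ry_def Ry_def
    by (rule crosses_graphs[OF uw, where t = 1])
      (use slopes(6) m in \<open>auto simp: spans_def divide_simps algebra_simps\<close>)
  have r11: "crosses rx ry"
    unfolding rx_def ry_def Rx_def Ry_def
  proof (rule crosses_graphs[OF uw slopes(3), where t = t0])
    have "\<epsilon> * (\<sigma> * k * c) + \<epsilon> * (- \<sigma> * k) * t0 = \<epsilon> * \<sigma> * (k * (c - t0))" by (simp add: algebra_simps)
    also have "\<dots> = \<epsilon> * \<sigma> * (j * (t0 - 1))" by (simp only: t0(3))
    finally show "\<epsilon> * (\<sigma> * k * c) + \<epsilon> * (- \<sigma> * k) * t0 = \<epsilon> * (- \<sigma> * j) + \<epsilon> * (\<sigma> * j) * t0"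
      by (simp add: algebra_simps)
    show "spans True ((t0 - M) / (1 - M))" using t0 m by (auto simp: spans_def divide_neg_neg)
  qed (use ts m in \<open>auto simp: spans_def\<close>)
  have r12: "\<forall>l\<in>L. crosses sv l \<and> crosses rx l \<and> crosses ry l"
    using \<epsilon>L unfolding sv_def rx_def ry_def S .
  show ?thesis
    by (intro exI[of _ sv] exI[of _ rx] exI[of _ ry] conjI r1 r2 r3 r4 r5 r6 r7 r8 r9 r10 r11 r12)
qed

section \<open>Bringing an arbitrary ray between two segments into normal form\<close>

lemma swap_segment:
  "points (Segment c d) = points (Segment d c)"
  "crosses l (Segment c d) \<longleftrightarrow> crosses l (Segment d c)"
  "ray_from_to l l' (Segment c d) \<longleftrightarrow> ray_from_to l l' (Segment d c)"
  by (simp_all add: crosses_def ray_from_to_def closed_segment_commute insert_commute disj_commute)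

text \<open>Since the ray meets the segments only in \<open>a\<close> and \<open>b\<close>, it
  cannot overlap either of them. As \<open>a\<close> is interior to \<open>Segment A B\<close>,
  parallelism there is excluded by \<open>transversal_if_isolated\<close>; as \<open>b\<close> is an
  end-point, the other segment needs its own argument.\<close>

lemma ray_from_to_transversal:
  assumes "ray_from_to r (Segment A B) (Segment b' C')" "A \<noteq> B" "b' \<noteq> C'"
  obtains a b C \<mu> where "r = Ray a b" "a \<noteq> b" "Segment b' C' = Segment b C \<or> Segment b' C' = Segment C b"
    "spans False \<mu>" "a = A + \<mu> *\<^sub>R (B - A)" "det2 (b - a) (B - A) \<noteq> 0" "det2 (b - a) (C - b) \<noteq> 0"
proof -
  obtain a b where ab: "a \<in> interior_points (Segment A B)" "b \<in> {b', C'}" "a \<noteq> b" "r = Ray a b"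
      "points (Ray a b) \<inter> (points (Segment A B) \<union> points (Segment b' C')) = {a, b}"
    using assms(1) unfolding ray_from_to_def by auto
  have on_ray: "p \<in> {a, b}"
    if "p = a + k *\<^sub>R (b - a)" "0 \<le> k" "p \<in> points (Segment A B) \<or> p \<in> points (Segment b' C')" for p k
  proof -
    have "p \<in> points (Ray a b)" using that by auto
    then show ?thesis using ab(5) that(3) by blast
  qed
  have off: "a + k *\<^sub>R (b - a) \<notin> {a, b}" if "k \<noteq> 0" "k \<noteq> 1" for k
  proof -
    have "(a + k *\<^sub>R (b - a)) - b = (k - 1) *\<^sub>R (b - a)" by (simp add: algebra_simps)
    then have "a + k *\<^sub>R (b - a) \<noteq> b" using that ab(3)
      by (metis diff_self eq_iff_diff_eq_0 scaleR_eq_0_iff)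
    then show ?thesis using that ab(3) by simp
  qed
  have seg: "Segment A B = line_obj False A B" by (simp add: line_obj_def)
  obtain \<mu> where \<mu>: "a = A + \<mu> *\<^sub>R (B - A)" "0 \<le> \<mu>" "\<mu> \<le> 1"
    using ab(1) unfolding interior_points_def seg points_line_obj by blast
  have s\<mu>: "spans False \<mu>"
    using spans_if_not_end_point[of \<mu> False A B] \<mu> ab(1) unfolding interior_points_def seg by auto
  have dx: "det2 (b - a) (B - A) \<noteq> 0"
  proof (rule transversal_if_isolated[OF assms(2) s\<mu> _ \<mu>(1)[symmetric], of _ 1])
    show "a + k *\<^sub>R (b - a) \<notin> points (line_obj False A B)" if "0 < k" "k < 1" for k
      using on_ray[OF refl, of k] off[of k] that unfolding seg by auto
  qed (use ab(3) in auto)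
  obtain C where C: "Segment b' C' = Segment b C \<or> Segment b' C' = Segment C b" "b \<noteq> C"
    using ab(2) assms(3) by auto
  have pC: "b + k *\<^sub>R (C - b) \<in> points (Segment b' C')" if "0 \<le> k" "k \<le> 1" for k
  proof -
    have "b + k *\<^sub>R (C - b) \<in> points (line_obj False b C)" using that by (force simp: points_line_obj)
    then show ?thesis using C(1) by (auto simp: line_obj_def closed_segment_commute[of C b])
  qed
  have "det2 (b - a) (C - b) \<noteq> 0"
  proof
    assume "det2 (b - a) (C - b) = 0"
    then obtain k where k: "C - b = k *\<^sub>R (b - a)" using det2_zero_parallel ab(3) by (metis right_minus_eq)
    then have "k \<noteq> 0" using C(2) by auto
    \<comment> \<open>Small enough that \<open>\<bar>y * k\<bar> < 1\<close>. For either sign of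
      \<open>k\<close>, the point at parameter \<open>1 + y * k\<close> then lies on the ray as well
      as on the segment, and differs from \<open>a\<close> and \<open>b\<close>.\<close>
    define y where "y = 1 / (1 + 2 * \<bar>k\<bar>)"
    have y: "0 < y" "y \<le> 1" by (auto simp: y_def)
    have yk: "\<bar>y * k\<bar> < 1" by (auto simp: y_def abs_mult divide_simps)
    have e: "b + y *\<^sub>R (C - b) = a + (1 + y * k) *\<^sub>R (b - a)" unfolding k by (simp add: algebra_simps)
    have "a + (1 + y * k) *\<^sub>R (b - a) \<in> {a, b}"
      by (rule on_ray[OF refl]) (use yk pC[of y] y e in auto)
    moreover have "1 + y * k \<noteq> 0" "1 + y * k \<noteq> 1" using yk y \<open>k \<noteq> 0\<close> by auto
    ultimately show False using off by blast
  qed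
  then show ?thesis using that ab C s\<mu> \<mu> dx by blast
qed

lemma extend_segments:
  fixes X Y :: bool
  assumes r: "ray_from_to r sx sy" and "is_segment sx" "is_segment sy" "finite L"
    and L: "\<forall>l\<in>L. (is_segment l \<or> is_ray l) \<and> crosses r l"
  obtains sv rx ry where "is_segment sv"
    "points sv \<inter> points sx \<noteq> {} \<longleftrightarrow> X" "points sv \<inter> points sy \<noteq> {} \<longleftrightarrow> Y"
    "ray_from_to rx sx sv" "ray_from_to ry sv sy" "crosses rx sy" "crosses ry sx"
    "crosses r sv" "crosses r rx" "crosses r ry" "crosses rx ry"
    "\<And>l. l \<in> L \<Longrightarrow> crosses sv l \<and> crosses rx l \<and> crosses ry l"
proof -
  obtain A B where sx: "sx = Segment A B" "A \<noteq> B" using assms(2) by (cases sx) auto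
  obtain b' C' where sy: "sy = Segment b' C'" "b' \<noteq> C'" using assms(3) by (cases sy) auto
  obtain a b C \<mu> where h: "r = Ray a b" "a \<noteq> b" "sy = Segment b C \<or> sy = Segment C b"
    "spans False \<mu>" "a = A + \<mu> *\<^sub>R (B - A)" "det2 (b - a) (B - A) \<noteq> 0" "det2 (b - a) (C - b) \<noteq> 0"
    using ray_from_to_transversal r sx(2) sy(2) unfolding sx(1) sy(1) by metis
  have hL: "\<forall>l\<in>L. \<exists>t>0. hits a (b - a) l t"
    using crosses_ray_hits[OF h(2)] L unfolding h(1) by metis
  note ex = extend_along_ray[OF h(4-7) \<open>finite L\<close> hL, of X Y]
  have sy': "points sy = points (Segment b C)" "\<And>l. crosses l sy \<longleftrightarrow> crosses l (Segment b C)"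
      "\<And>l l'. ray_from_to l l' sy \<longleftrightarrow> ray_from_to l l' (Segment b C)"
    using h(3) swap_segment by metis+
  show thesis using ex unfolding sx(1)[symmetric] h(1)[symmetric] sy'[symmetric] by (elim exE conjE) (erule that, assumption+, blast)
qed

section \<open>Induction over the 2-tree\<close>

text \<open>Here \<open>(V, E)\<close> is the 2-tree and \<open>F\<close> the edge set of its spanning subgraph.\<close>

definition represents ::
  "'a set \<Rightarrow> 'a set set \<Rightarrow> 'a set set \<Rightarrow> ('a \<Rightarrow> line_object) \<Rightarrow> ('a set \<Rightarrow> line_object) \<Rightarrow> bool"
where
  "represents V E F s r \<longleftrightarrow>
     (\<forall>u\<in>V. is_segment (s u)) \<and>
     (\<forall>u\<in>V. \<forall>v\<in>V. u \<noteq> v \<longrightarrow> (points (s u) \<inter> points (s v) \<noteq> {} \<longleftrightarrow> {u, v} \<notin> F)) \<and>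
     (\<forall>u v. {u, v} \<in> E \<longrightarrow> ray_from_to (r {u, v}) (s u) (s v) \<or> ray_from_to (r {u, v}) (s v) (s u)) \<and>
     (\<forall>e\<in>E. \<forall>w\<in>V - e. crosses (r e) (s w)) \<and>
     (\<forall>e\<in>E. \<forall>e'\<in>E - {e}. crosses (r e) (r e'))"

text \<open>The orientation of \<open>r {x, y}\<close> from \<open>x\<close> to \<open>y\<close> is
  no restriction, since \<open>x\<close> and \<open>y\<close> play symmetric roles.\<close>

lemma represents_add_vertex:
  assumes "simple_graph (V, E)" and xy: "{x, y} \<in> E" and "v \<notin> V"
    and F: "F \<subseteq> E \<union> {{v, x}, {v, y}}" and rep: "represents V E (F \<inter> E) s r"
    and r0: "ray_from_to (r {x, y}) (s x) (s y)"
  shows "\<exists>s r. represents (insert v V) (E \<union> {{v, x}, {v, y}}) F s r"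
proof -
  have finV: "finite V" and edge: "\<And>e. e \<in> E \<Longrightarrow> \<exists>p\<in>V. \<exists>q\<in>V. p \<noteq> q \<and> e = {p, q}"
    using assms(1) by (auto simp: simple_graph_def)
  have sub: "e \<subseteq> V" if "e \<in> E" for e using edge[OF that] by auto
  have "finite E" using finV sub by (meson Pow_iff finite_Pow_iff finite_subset subsetI)
  have V: "x \<in> V" "y \<in> V" using sub[OF xy] by auto
  have "x \<noteq> y" using edge[OF xy] by (auto simp: doubleton_eq_iff)
  note R = rep[unfolded represents_def]
  have seg: "is_segment (s p)" if "p \<in> V" for p
    using conjunct1[OF R] that by blast
  note R = conjunct2[OF R]
  have meet: "points (s p) \<inter> points (s q) \<noteq> {} \<longleftrightarrow> {p, q} \<notin> F \<inter> E" if "p \<in> V" "q \<in> V" "p \<noteq> q" for p q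
    using conjunct1[OF R] that by simp
  note R = conjunct2[OF R]
  have ray: "ray_from_to (r {p, q}) (s p) (s q) \<or> ray_from_to (r {p, q}) (s q) (s p)" if "{p, q} \<in> E" for p q
    using conjunct1[OF R] that by simp
  note R = conjunct2[OF R]
  have cs: "crosses (r e) (s w)" if "e \<in> E" "w \<in> V" "w \<notin> e" for e w
    using conjunct1[OF R] that by simp
  have cr: "crosses (r e) (r e')" if "e \<in> E" "e' \<in> E" "e \<noteq> e'" for e e'
    using conjunct2[OF R] that by simp
  \<comment> \<open>Everything that the ray of the edge \<open>{x, y}\<close> crosses in the old
    representation.\<close>
  define L where "L = s ` (V - {x, y}) \<union> r ` (E - {{x, y}})"
  have LL: "\<forall>l\<in>L. (is_segment l \<or> is_ray l) \<and> crosses (r {x, y}) l"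
  proof -
    have "is_ray (r e)" if "e \<in> E" for e
      using edge[OF that] ray that unfolding ray_from_to_def by metis
    then show ?thesis using seg cs[OF xy] cr[OF xy] unfolding L_def by auto
  qed
  have finL: "finite L" using finV \<open>finite E\<close> by (simp add: L_def)
  obtain sv rx ry where
    new: "is_segment sv" "points sv \<inter> points (s x) \<noteq> {} \<longleftrightarrow> {v, x} \<notin> F"
      "points sv \<inter> points (s y) \<noteq> {} \<longleftrightarrow> {v, y} \<notin> F"
      "ray_from_to rx (s x) sv" "ray_from_to ry sv (s y)" "crosses rx (s y)" "crosses ry (s x)"
      "crosses (r {x, y}) sv" "crosses (r {x, y}) rx" "crosses (r {x, y}) ry" "crosses rx ry"
      and newL: "\<And>l. l \<in> L \<Longrightarrow> crosses sv l \<and> crosses rx l \<and> crosses ry l"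
    using extend_segments[OF r0 seg[OF V(1)] seg[OF V(2)] finL LL,
      where X = "{v, x} \<notin> F" and Y = "{v, y} \<notin> F"] by blast
  define s' where "s' = s(v := sv)"
  define r' where "r' = r({v, x} := rx, {v, y} := ry)"
  have neq: "{v, x} \<noteq> {v, y}" using \<open>x \<noteq> y\<close> by (auto simp: doubleton_eq_iff)
  have notE: "e \<noteq> {v, x}" "e \<noteq> {v, y}" "v \<notin> e" if "e \<in> E" for e using sub[OF that] \<open>v \<notin> V\<close> by auto
  have s': "s' v = sv" "\<And>w. w \<in> V \<Longrightarrow> s' w = s w" using \<open>v \<notin> V\<close> by (auto simp: s'_def)
  have r': "r' {v, x} = rx" "r' {v, y} = ry" "\<And>e. e \<in> E \<Longrightarrow> r' e = r e"
    using neq notE by (auto simp: r'_def)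
  have vs: "crosses rx (s w)" "crosses ry (s w)" "crosses sv (s w)" if "w \<in> V" "w \<noteq> x" "w \<noteq> y" for w
    using newL[of "s w"] that by (auto simp: L_def)
  have vr: "crosses rx (r e)" "crosses ry (r e)" "crosses (r e) sv" if "e \<in> E" for e
    using newL[of "r e"] new(8-10) that crosses_sym by (cases "e = {x, y}"; auto simp: L_def)+
  have vmeet: "points sv \<inter> points (s w) \<noteq> {} \<longleftrightarrow> {v, w} \<notin> F" if "w \<in> V" for w
  proof (cases "w = x \<or> w = y")
    case True
    then show ?thesis using new(2,3) by blast
  next
    case False
    \<comment> \<open>Edges of \<open>F\<close> at \<open>v\<close> lead only to \<open>x\<close>
      and \<open>y\<close>, so the new segment has to meet \<open>s w\<close>; this is part of its
      crossing all of \<open>L\<close>.\<close>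
    then have "{v, w} \<notin> F" using F notE(3)[of "{v, w}"] by (auto simp: doubleton_eq_iff)
    moreover have "points sv \<inter> points (s w) \<noteq> {}"
      using vs(3)[OF that] False unfolding crosses_def by auto
    ultimately show ?thesis by simp
  qed
  have "represents (insert v V) (E \<union> {{v, x}, {v, y}}) F s' r'"
    unfolding represents_def
  proof (intro conjI ballI allI impI)
    show "is_segment (s' p)" if "p \<in> insert v V" for p using that seg new(1) s' by auto
    show "points (s' p) \<inter> points (s' q) \<noteq> {} \<longleftrightarrow> {p, q} \<notin> F"
      if pq: "p \<in> insert v V" "q \<in> insert v V" "p \<noteq> q" for p q
    proof -
      consider "p = v" "q \<in> V" | "q = v" "p \<in> V" | "p \<in> V" "q \<in> V" using pq by blast
      then show ?thesis
      proof cases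
        case 1
        then show ?thesis using vmeet s' by simp
      next
        case 2
        then show ?thesis using vmeet[of p] s' by (simp add: Int_commute insert_commute)
      next
        case 3
        then have "{p, q} \<noteq> {v, x}" "{p, q} \<noteq> {v, y}" using \<open>v \<notin> V\<close> by (auto simp: doubleton_eq_iff)
        then have "{p, q} \<notin> F \<inter> E \<longleftrightarrow> {p, q} \<notin> F" using F by blast
        then show ?thesis using meet[OF 3 pq(3)] s'(2) 3 by simp
      qed
    qed
    show "ray_from_to (r' {p, q}) (s' p) (s' q) \<or> ray_from_to (r' {p, q}) (s' q) (s' p)"
      if pq: "{p, q} \<in> E \<union> {{v, x}, {v, y}}" for p q
    proof -
      consider "{p, q} \<in> E" | "{p, q} = {v, x}" | "{p, q} = {v, y}" using pq by blast
      then show ?thesis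
      proof cases
        case 1
        then show ?thesis using ray[OF 1] sub[OF 1] s'(2) r'(3) by simp
      next
        case 2
        then have "p = v \<and> q = x \<or> p = x \<and> q = v" by (auto simp: doubleton_eq_iff)
        then show ?thesis unfolding 2 r'(1) using new(4) s' V by auto
      next
        case 3
        then have "p = v \<and> q = y \<or> p = y \<and> q = v" by (auto simp: doubleton_eq_iff)
        then show ?thesis unfolding 3 r'(2) using new(5) s' V by auto
      qed
    qed
    show "crosses (r' e) (s' w)" if ew: "e \<in> E \<union> {{v, x}, {v, y}}" "w \<in> insert v V - e" for e w
    proof -
      consider "e \<in> E" "w = v" | "e \<in> E" "w \<in> V" | "e = {v, x}" | "e = {v, y}" using ew by blast
      then show ?thesis
      proof cases
        case 3
        then have "w \<in> V" "w \<noteq> x" using ew by auto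
        then show ?thesis using new(6) vs(1)[of w] 3 s' r' by (cases "w = y") auto
      next
        case 4
        then have "w \<in> V" "w \<noteq> y" using ew by auto
        then show ?thesis using new(7) vs(2)[of w] 4 s' r' by (cases "w = x") auto
      qed (use vr(3) cs ew s' r' in auto)
    qed
    show "crosses (r' e) (r' e')"
      if "e \<in> E \<union> {{v, x}, {v, y}}" "e' \<in> E \<union> {{v, x}, {v, y}} - {e}" for e e'
    proof -
      have "crosses ry rx" "\<And>e. e \<in> E \<Longrightarrow> crosses (r e) rx" "\<And>e. e \<in> E \<Longrightarrow> crosses (r e) ry"
        using new(11) vr(1,2) crosses_sym by blast+
      then show ?thesis
        using that new(11) vr(1,2) cr[of e e'] r' by (cases "e \<in> E \<and> e' \<in> E") auto
    qed
  qed
  then show ?thesis by blast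
qed

text \<open>The first segment is vertical through the origin, and the ray is the positive horizontal
  axis. The second segment rises from \<open>C\<close> on this axis, either vertically or slanting
  back to cross the first at height 1/2.\<close>

lemma represents_single_edge:
  assumes "u \<noteq> v"
  shows "\<exists>s r. represents {u, v} {{u, v}} F s r"
proof -
  define k :: real where "k = (if {u, v} \<in> F then 1 else - 1)"
  define A B C D :: point
    where "A = vector [0, - 1]" and "B = vector [0, 1]" and "C = vector [1, 0]" and "D = vector [k, 1]"
  note defs = A_def B_def C_def D_def
  have "ray_from_to (Ray 0 C) (Segment A B) (Segment C D)"
    by (rule ray_from_to_segmentsI[of _ _ _ _ _ _ "1 / 2"])
      (auto simp: defs det2_def spans_def vec_eq_iff forall_2)
  moreover have "points (Segment A B) \<inter> points (Segment C D) \<noteq> {} \<longleftrightarrow> {u, v} \<notin> F"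
  proof (cases "{u, v} \<in> F")
    case True
    have "p $ 1 = 0" if "p \<in> closed_segment A B" for p
      using that by (auto simp: closed_segment_def defs)
    moreover have "p $ 1 = 1" if "p \<in> closed_segment C D" for p
      using that True by (auto simp: closed_segment_def defs k_def)
    ultimately show ?thesis using True by fastforce
  next
    case False
    have "crosses (line_obj False A B) (line_obj False C D)"
      by (rule crossesI[of _ _ _ _ _ "3 / 4" _ "1 / 2"])
        (use False in \<open>auto simp: defs det2_def spans_def vec_eq_iff forall_2 k_def\<close>)
    then show ?thesis using False by (auto simp: crosses_def line_obj_def)
  qed
  moreover have "A \<noteq> B" "C \<noteq> D" by (auto simp: defs vec_eq_iff forall_2)
  ultimately have "represents {u, v} {{u, v}} F
      (\<lambda>w. if w = u then Segment A B else Segment C D) (\<lambda>_. Ray 0 C)"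
    using assms unfolding represents_def
    by (auto simp: doubleton_eq_iff insert_commute Int_commute)
  then show ?thesis by blast
qed

text \<open>\<open>F\<close> must stay arbitrary in the induction, because the smaller 2-tree is
  used with \<open>F \<inter> E\<close>.\<close>

lemma two_tree_represents:
  assumes "two_tree T" "F \<subseteq> edges T"
  shows "\<exists>s r. represents (verts T) (edges T) F s r"
  using assms
proof (induction arbitrary: F rule: two_tree.induct)
  case (single_edge u v)
  then show ?case using represents_single_edge by simp
next
  case (add_vertex V E x y v)
  obtain s r where sr: "represents V E (F \<inter> E) s r" using add_vertex.IH[of "F \<inter> E"] by auto
  have simp: "simple_graph (V, E)" using two_tree_simple[OF add_vertex.hyps(1)] .
  have F: "F \<subseteq> E \<union> {{v, x}, {v, y}}" using add_vertex.prems by simp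
  have "ray_from_to (r {x, y}) (s x) (s y) \<or> ray_from_to (r {x, y}) (s y) (s x)"
    using sr add_vertex.hyps(2) unfolding represents_def by blast
  then show ?case
  proof
    assume "ray_from_to (r {x, y}) (s x) (s y)"
    from represents_add_vertex[OF simp add_vertex.hyps(2,3) F sr this] show ?thesis by simp
  next
    assume "ray_from_to (r {x, y}) (s y) (s x)"
    moreover have "{y, x} = {x, y}" by blast
    ultimately show ?thesis
      using represents_add_vertex[OF simp, of y x v F s r] add_vertex.hyps(2,3) F sr
      by (simp add: insert_commute)
  qed
qed

theorem theorem1:
  fixes G G\<^sub>T :: "'a graph"
  assumes "partial_two_tree G"
    and "two_tree G\<^sub>T"
    and "spanning_subgraph G G\<^sub>T"
  shows "\<exists>s. segment_representation (complement G) s \<and> compatible s G\<^sub>T"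
proof -
  have G: "verts G = verts G\<^sub>T" "edges G \<subseteq> edges G\<^sub>T"
    using assms(3) by (auto simp: spanning_subgraph_def)
  obtain s r where sr: "represents (verts G\<^sub>T) (edges G\<^sub>T) (edges G) s r"
    using two_tree_represents[OF assms(2) G(2)] by blast
  have "{u, v} \<in> edges (complement G) \<longleftrightarrow> {u, v} \<notin> edges G"
    if "u \<in> verts G" "v \<in> verts G" "u \<noteq> v" for u v
    using that unfolding complement_def by auto
  then have "segment_representation (complement G) s"
    using sr unfolding segment_representation_def represents_def G(1)[symmetric]
    by (simp add: complement_def)
  moreover have "compatible s G\<^sub>T"
    unfolding compatible_def
  proof (intro exI[of _ r] allI impI conjI ballI)
    fix u v assume uv: "{u, v} \<in> edges G\<^sub>T"
    note R = sr[unfolded represents_def, THEN conjunct2, THEN conjunct2]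
    show "ray_from_to (r {u, v}) (s u) (s v) \<or> ray_from_to (r {u, v}) (s v) (s u)"
      using conjunct1[OF R] uv by simp
    show "crosses (r {u, v}) (s w)" if "w \<in> verts G\<^sub>T - {u, v}" for w
      using conjunct1[OF conjunct2[OF R]] uv that by blast
    show "crosses (r {u, v}) (r e)" if "e \<in> edges G\<^sub>T - {{u, v}}" for e
      using conjunct2[OF conjunct2[OF R]] uv that by blast
  qed
  ultimately show ?thesis by blast
qed

end
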